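(* Let $x(t)=(x_1(t),\dots,x_n(t))$, $t\ge0$, be a solution of the RoPE spherical self-attention flow on $(\mathbb{S}^{d-1})^n$ (arbitrary fixed positions, frequencies, and finite $\beta\ge0$), put $\underline a=\dfrac{1}{1+(n-1)e^{2\beta}}$, and let $$c(t)=\min_{i<j}\langle x_i(t),x_j(t)\rangle.$$ If $c(0)=c_0\ge0$, then for all $t\ge 0$, $c(t)\ge0$ and $$D^{+}c(t)\ge2\underline a\bigl(1-c(t)^2\bigr).$$ With $$\rho(t)=\frac{1-c(t)}{1+c(t)},\qquad \rho_0=\frac{1-c_0}{1+c_0},$$ one has $$\rho(t)\le\rho_0e^{-4\underline a t}.$$ Equivalently, for the pairwise geodesic diameter $D_{\mathbb{S}}(t)=\arccos c(t)$, $$\tan\frac{D_{\mathbb{S}}(t)}2\le\tan\frac{D_{\mathbb{S}}(0)}2\,e^{-2\underline a t}.$$ If $c_0=0$, then $c(t)\ge\tanh(2\underline a t)>0$ for every $t>0$.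
   Context: Let $n\ge2$ and $d=2r$ with $r\ge1$. Token $i$ has a fixed position $p_i\in\mathbb{R}$ and state $x_i\in\mathbb{S}^{d-1}$. For real frequencies $\omega_1,\dots,\omega_r$, define the block rotation $R_p=\bigoplus_{\ell=1}^r\begin{pmatrix}\cos(\omega_\ell p)&-\sin(\omega_\ell p)\\ \sin(\omega_\ell p)&\cos(\omega_\ell p)\end{pmatrix}$. For finite $\beta\ge0$: $s_{ij}(x)=\langle R_{p_i}x_i,R_{p_j}x_j\rangle$, $W_{ij}(x)=e^{\beta s_{ij}(x)}$, $Z_i(x)=\sum_kW_{ik}(x)$, $A_{ij}(x)=W_{ij}(x)/Z_i(x)$. The flow is $\dot x_i=\sum_{j=1}^nA_{ij}(x)(x_j-\langle x_i,x_j\rangle x_i)$; it has a unique global solution for every initial state in $(\mathbb{S}^{d-1})^n$. $D^+f(t)=\limsup_{h\downarrow0}\frac{f(t+h)-f(t)}{h}$ is the upper right Dini derivative. *)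

theory Defs
  imports "HOL-Analysis.Analysis"
begin

definition rot2 :: "real \<Rightarrow> real^2^2" where
  "rot2 \<theta> = vector [vector [cos \<theta>, - sin \<theta>], vector [sin \<theta>, cos \<theta>]]"

text \<open>The space of dimension \<open>d = 2r\<close> is \<open>real^('r \<times> 2)\<close> with \<open>r = CARD('r)\<close>: coordinate
  \<open>(l, a)\<close> is the \<open>a\<close>-th coordinate of the \<open>l\<close>-th two-dimensional block, so the matrix below is
  block diagonal.\<close>

definition rope_matrix :: "('r::finite \<Rightarrow> real) \<Rightarrow> real \<Rightarrow> real^('r \<times> 2)^('r \<times> 2)" where
  "rope_matrix \<omega> q =
    (\<chi> u v. if fst u = fst v then rot2 (\<omega> (fst u) * q) $ snd u $ snd v else 0)"

text \<open>Tokens are indexed by \<open>1, \<dots>, n\<close>; a configuration \<open>y\<close> maps indices to states, and its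
  values outside \<open>{1..n}\<close> are irrelevant.\<close>

definition rope_score ::
  "(nat \<Rightarrow> real) \<Rightarrow> ('r::finite \<Rightarrow> real) \<Rightarrow> (nat \<Rightarrow> real^('r \<times> 2)) \<Rightarrow> nat \<Rightarrow> nat \<Rightarrow> real" where
  "rope_score p \<omega> y i j = (rope_matrix \<omega> (p i) *v y i) \<bullet> (rope_matrix \<omega> (p j) *v y j)"

definition rope_weight ::
  "(nat \<Rightarrow> real) \<Rightarrow> ('r::finite \<Rightarrow> real) \<Rightarrow> real \<Rightarrow> (nat \<Rightarrow> real^('r \<times> 2)) \<Rightarrow> nat \<Rightarrow> nat \<Rightarrow> real" where
  "rope_weight p \<omega> \<beta> y i j = exp (\<beta> * rope_score p \<omega> y i j)"

definition rope_partition ::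
  "nat \<Rightarrow> (nat \<Rightarrow> real) \<Rightarrow> ('r::finite \<Rightarrow> real) \<Rightarrow> real \<Rightarrow> (nat \<Rightarrow> real^('r \<times> 2)) \<Rightarrow> nat \<Rightarrow> real" where
  "rope_partition n p \<omega> \<beta> y i = (\<Sum>k=1..n. rope_weight p \<omega> \<beta> y i k)"

definition rope_attention ::
  "nat \<Rightarrow> (nat \<Rightarrow> real) \<Rightarrow> ('r::finite \<Rightarrow> real) \<Rightarrow> real \<Rightarrow> (nat \<Rightarrow> real^('r \<times> 2)) \<Rightarrow> nat \<Rightarrow> nat \<Rightarrow> real"
  where
  "rope_attention n p \<omega> \<beta> y i j = rope_weight p \<omega> \<beta> y i j / rope_partition n p \<omega> \<beta> y i"

definition rope_field ::
  "nat \<Rightarrow> (nat \<Rightarrow> real) \<Rightarrow> ('r::finite \<Rightarrow> real) \<Rightarrow> real \<Rightarrow> (nat \<Rightarrow> real^('r \<times> 2)) \<Rightarrow> nat \<Rightarrow> real^('r \<times> 2)"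
  where
  "rope_field n p \<omega> \<beta> y i =
    (\<Sum>j=1..n. rope_attention n p \<omega> \<beta> y i j *\<^sub>R (y j - (y i \<bullet> y j) *\<^sub>R y i))"

text \<open>Solutions on \<open>[0, \<infinity>)\<close> with values in the product of spheres; the derivative at \<open>0\<close> is
  one-sided.\<close>

definition rope_flow_solution ::
  "nat \<Rightarrow> (nat \<Rightarrow> real) \<Rightarrow> ('r::finite \<Rightarrow> real) \<Rightarrow> real \<Rightarrow> (real \<Rightarrow> nat \<Rightarrow> real^('r \<times> 2)) \<Rightarrow> bool" where
  "rope_flow_solution n p \<omega> \<beta> x \<longleftrightarrow>
    (\<forall>t\<ge>0. \<forall>i\<in>{1..n}. x t i \<in> sphere 0 1 \<and>
      ((\<lambda>s. x s i) has_vector_derivative rope_field n p \<omega> \<beta> (x t) i) (at t within {0..}))"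

definition min_pair_inner :: "nat \<Rightarrow> (nat \<Rightarrow> 'a::real_inner) \<Rightarrow> real" where
  "min_pair_inner n y = Min {y i \<bullet> y j | i j. 1 \<le> i \<and> i < j \<and> j \<le> n}"

text \<open>The geodesic distance of two points of the unit sphere is the arccosine of their
  inner product.\<close>

definition geodesic_diameter :: "nat \<Rightarrow> (nat \<Rightarrow> 'a::real_inner) \<Rightarrow> real" where
  "geodesic_diameter n y = Max {arccos (y i \<bullet> y j) | i j. 1 \<le> i \<and> i < j \<and> j \<le> n}"

definition upper_right_Dini :: "(real \<Rightarrow> real) \<Rightarrow> real \<Rightarrow> ereal" where
  "upper_right_Dini f t = Limsup (at_right 0) (\<lambda>h. ereal ((f (t + h) - f t) / h))"

end

theory Submission
  imports Defs
begin

text \<open>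
  Consider a pair \<open>(i, j)\<close> whose inner product \<open>c\<close> is minimal among all pairs. Its derivative is
  the sum of \<open>A i k * (\<langle>x k, x j\<rangle> - c * \<langle>x i, x k\<rangle>)\<close> over \<open>k\<close> and of the same expression with
  \<open>i\<close> and \<open>j\<close> exchanged. If \<open>c \<ge> 0\<close>, minimality makes every summand nonnegative, as
  \<open>\<langle>x k, x j\<rangle> \<ge> c \<ge> c * \<langle>x i, x k\<rangle>\<close>. The summands in which \<open>x k\<close> is the partner itself contribute
  \<open>(A i j + A j i) * (1 - c\<^sup>2)\<close>, and rotations are isometries, so scores lie in \<open>[-1, 1]\<close> and every
  attention weight is at least \<open>a\<close>. Hence minimal pairs grow at rate at least \<open>2 * a * (1 - c\<^sup>2)\<close>
  (\<open>pair_inner_deriv_ge\<close>).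

  The minimum of finitely many differentiable functions need not be differentiable, but what
  is known about the functions attaining it suffices: it bounds the Dini derivative
  (\<open>upper_right_Dini_Min_ge\<close>), and it keeps every member of the family above a constant that
  bounds all of them initially (\<open>family_lower_bound_preserved\<close>). The latter replaces a
  differential inequality for the minimum and is used twice. Applied to
  \<open>exp (-4 * t) * \<langle>x i, x j\<rangle>\<close> it shows that \<open>c\<close> stays nonnegative; this needs the estimate
  \<open>4 * c\<close> for the derivative of a minimal pair with \<open>c < 0\<close>. Applied to
  \<open>- exp (4 * a * t) * (1 - \<langle>x i, x j\<rangle>) / (1 + \<langle>x i, x j\<rangle>)\<close> it gives the decay of \<open>\<rho>\<close>, because
  \<open>u' = 2 * a * (1 - u\<^sup>2)\<close> is equivalent to \<open>(1 - u) / (1 + u)\<close> decaying at the exact rate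
  \<open>4 * a\<close>. The remaining claims reformulate this decay through \<open>tan (arccos c / 2) = sqrt \<rho>\<close> and
  \<open>tanh s = (1 - exp (-2 * s)) / (1 + exp (-2 * s))\<close>.
\<close>

section \<open>Scores and attention weights\<close>

lemma rope_matrix_mult_vec_nth:
  "(rope_matrix \<omega> q *v z) $ (l, b) =
    rot2 (\<omega> l * q) $ b $ 1 * z $ (l, 1) + rot2 (\<omega> l * q) $ b $ 2 * z $ (l, 2)"
proof -
  have "(rope_matrix \<omega> q *v z) $ (l, b) =
      (\<Sum>m\<in>UNIV. \<Sum>e\<in>UNIV. (if l = m then rot2 (\<omega> l * q) $ b $ e else 0) * z $ (m, e))"
    unfolding matrix_vector_mult_def rope_matrix_def UNIV_Times_UNIV[symmetric]
      sum.cartesian_product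
    by (auto intro!: sum.cong)
  also have "\<dots> = (\<Sum>m\<in>UNIV. if l = m then \<Sum>e\<in>UNIV. rot2 (\<omega> l * q) $ b $ e * z $ (l, e) else 0)"
    by (intro sum.cong) auto
  finally show ?thesis by (simp add: sum_2)
qed

lemma norm_rope_matrix_mult_vec: "norm (rope_matrix \<omega> q *v z) = norm z"
proof -
  have block: "(cos t * u - sin t * v)\<^sup>2 + (sin t * u + cos t * v)\<^sup>2 = u\<^sup>2 + v\<^sup>2" for t u v :: real
  proof -
    have "(cos t * u - sin t * v)\<^sup>2 + (sin t * u + cos t * v)\<^sup>2
        = ((sin t)\<^sup>2 + (cos t)\<^sup>2) * (u\<^sup>2 + v\<^sup>2)"
      unfolding power2_eq_square by algebra
    then show ?thesis by simp
  qed
  have sum_blocks: "w \<bullet> w = (\<Sum>l\<in>UNIV. (w $ (l, 1))\<^sup>2 + (w $ (l, 2))\<^sup>2)" for w :: "real^('a \<times> 2)"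
  proof -
    have "w \<bullet> w = (\<Sum>l\<in>UNIV. \<Sum>e\<in>UNIV. (w $ (l, e))\<^sup>2)"
      by (simp add: inner_vec_def power2_eq_square sum.cartesian_product
          case_prod_beta flip: UNIV_Times_UNIV)
    then show ?thesis by (simp add: sum_2)
  qed
  show ?thesis
    by (simp add: norm_eq_sqrt_inner sum_blocks rope_matrix_mult_vec_nth rot2_def block)
qed

lemma abs_rope_score_le_1:
  assumes "norm (y i) = 1" "norm (y j) = 1"
  shows "\<bar>rope_score p \<omega> y i j\<bar> \<le> 1"
  using Cauchy_Schwarz_ineq2[of "rope_matrix \<omega> (p i) *v y i" "rope_matrix \<omega> (p j) *v y j"] assms
  by (simp add: rope_score_def norm_rope_matrix_mult_vec)

lemma rope_partition_pos:
  assumes "i \<in> {1..n}"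
  shows "rope_partition n p \<omega> \<beta> y i > 0"
  using assms by (auto simp: rope_partition_def rope_weight_def intro!: sum_pos)

lemma rope_attention_nonneg:
  assumes "i \<in> {1..n}"
  shows "rope_attention n p \<omega> \<beta> y i j \<ge> 0"
  using rope_partition_pos[OF assms, of p \<omega> \<beta> y]
  by (simp add: rope_attention_def rope_weight_def)

lemma sum_rope_attention:
  assumes "i \<in> {1..n}"
  shows "(\<Sum>j=1..n. rope_attention n p \<omega> \<beta> y i j) = 1"
  using rope_partition_pos[OF assms, of p \<omega> \<beta> y]
  by (simp add: rope_attention_def rope_partition_def flip: sum_divide_distrib)

text \<open>Scores lie in \<open>[-1, 1]\<close>, so two weights in the same row differ by a factor of at most
  \<open>exp (2 * \<beta>)\<close>. Normalising by the entry in question leaves one term equal to \<open>1\<close> and \<open>n - 1\<close>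
  terms bounded by this factor.\<close>

lemma rope_attention_ge:
  assumes sph: "\<And>k. k \<in> {1..n} \<Longrightarrow> norm (y k) = 1" and "\<beta> \<ge> 0"
    and i: "i \<in> {1..n}" and j: "j \<in> {1..n}"
  shows "rope_attention n p \<omega> \<beta> y i j \<ge> 1 / (1 + (real n - 1) * exp (2 * \<beta>))"
proof -
  let ?W = "rope_weight p \<omega> \<beta> y i"
  have W: "?W k \<le> exp (2 * \<beta>) * ?W j" if k: "k \<in> {1..n}" for k
  proof -
    have "rope_score p \<omega> y i k \<le> 2 + rope_score p \<omega> y i j"
      using abs_rope_score_le_1[of y i k p \<omega>] abs_rope_score_le_1[of y i j p \<omega>] sph i j k by auto
    from mult_left_mono[OF this \<open>\<beta> \<ge> 0\<close>] show ?thesis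
      by (simp add: rope_weight_def algebra_simps flip: exp_add)
  qed
  have "rope_partition n p \<omega> \<beta> y i = ?W j + (\<Sum>k\<in>{1..n} - {j}. ?W k)"
    unfolding rope_partition_def using j by (intro sum.remove) auto
  also have "\<dots> \<le> ?W j + (\<Sum>k\<in>{1..n} - {j}. exp (2 * \<beta>) * ?W j)"
    using W by (intro add_left_mono sum_mono) auto
  also have "\<dots> = (1 + (real n - 1) * exp (2 * \<beta>)) * ?W j"
    using j by (simp add: of_nat_diff algebra_simps)
  finally have le: "rope_partition n p \<omega> \<beta> y i \<le> (1 + (real n - 1) * exp (2 * \<beta>)) * ?W j" .
  have "1 + (real n - 1) * exp (2 * \<beta>) > 0"
    using i by (intro add_pos_nonneg mult_nonneg_nonneg) auto
  with le rope_partition_pos[OF i, of p \<omega> \<beta> y] show ?thesis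
    by (simp add: rope_attention_def field_simps)
qed

section \<open>The field at a pair of minimal inner product\<close>

lemma inner_rope_field:
  "rope_field n p \<omega> \<beta> y i \<bullet> z =
    (\<Sum>k=1..n. rope_attention n p \<omega> \<beta> y i k * (y k \<bullet> z - (y i \<bullet> y k) * (y i \<bullet> z)))"
  by (simp add: rope_field_def inner_sum_left inner_diff_left)

lemma inner_bounds_of_unit:
  fixes u v :: "'a::real_inner"
  assumes "norm u = 1" "norm v = 1"
  shows "u \<bullet> v \<le> 1" and "-1 \<le> u \<bullet> v"
  using Cauchy_Schwarz_ineq2[of u v] assms by auto

text \<open>No token pulls a minimal pair with \<open>\<langle>y i, y j\<rangle> \<ge> 0\<close> apart, so the whole field does at least as
  well as the attraction of \<open>y i\<close> to its partner \<open>y j\<close>. Minimality is required over all index pairs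
  \<open>k, l\<close>, including equal ones, so that the hypothesis covers \<open>k = j\<close>.\<close>

lemma inner_rope_field_ge_if_min_nonneg:
  assumes sph: "\<And>k. k \<in> {1..n} \<Longrightarrow> norm (y k) = 1" and "\<beta> \<ge> 0"
    and i: "i \<in> {1..n}" and j: "j \<in> {1..n}"
    and min: "\<And>k l. k \<in> {1..n} \<Longrightarrow> l \<in> {1..n} \<Longrightarrow> y i \<bullet> y j \<le> y k \<bullet> y l"
    and nn: "y i \<bullet> y j \<ge> 0"
  shows "rope_field n p \<omega> \<beta> y i \<bullet> y j \<ge>
    1 / (1 + (real n - 1) * exp (2 * \<beta>)) * (1 - (y i \<bullet> y j)\<^sup>2)"
proof -
  let ?c = "y i \<bullet> y j" and ?A = "rope_attention n p \<omega> \<beta> y i"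
  let ?g = "\<lambda>k. ?A k * (y k \<bullet> y j - (y i \<bullet> y k) * ?c)"
  have "?g k \<ge> 0" if k: "k \<in> {1..n}" for k
  proof -
    have "(y i \<bullet> y k) * ?c \<le> 1 * ?c"
      using inner_bounds_of_unit[OF sph[OF i] sph[OF k]] nn by (intro mult_right_mono)
    also have "\<dots> \<le> y k \<bullet> y j" using min k j by simp
    finally show ?thesis
      by (intro mult_nonneg_nonneg rope_attention_nonneg[OF i]) simp
  qed
  then have "?g j \<le> (\<Sum>k=1..n. ?g k)"
    using j by (intro member_le_sum) auto
  moreover have "?g j = ?A j * (1 - ?c\<^sup>2)"
    using sph[OF j] by (simp add: dot_square_norm power2_eq_square)
  moreover have "1 / (1 + (real n - 1) * exp (2 * \<beta>)) * (1 - ?c\<^sup>2) \<le> ?A j * (1 - ?c\<^sup>2)"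
    using rope_attention_ge[of n y \<beta> i j p \<omega>, OF sph \<open>\<beta> \<ge> 0\<close> i j]
      inner_bounds_of_unit[OF sph[OF i] sph[OF j]] nn
    by (intro mult_right_mono) (auto simp: abs_square_le_1)
  ultimately show ?thesis by (simp add: inner_rope_field)
qed

text \<open>Below \<open>0\<close> some tokens may pull the pair further apart. Each bracket
  \<open>\<langle>y k, y j\<rangle> - c * \<langle>y i, y k\<rangle>\<close> is still at least \<open>c + c\<close>, and the weights of a row sum to \<open>1\<close>. The
  bound is linear in \<open>c\<close>, which rules out that the minimum crosses \<open>0\<close> downwards.\<close>

lemma inner_rope_field_ge_if_min_neg:
  assumes sph: "\<And>k. k \<in> {1..n} \<Longrightarrow> norm (y k) = 1"
    and i: "i \<in> {1..n}" and j: "j \<in> {1..n}"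
    and min: "\<And>k l. k \<in> {1..n} \<Longrightarrow> l \<in> {1..n} \<Longrightarrow> y i \<bullet> y j \<le> y k \<bullet> y l"
    and neg: "y i \<bullet> y j < 0"
  shows "rope_field n p \<omega> \<beta> y i \<bullet> y j \<ge> 2 * (y i \<bullet> y j)"
proof -
  let ?c = "y i \<bullet> y j" and ?A = "rope_attention n p \<omega> \<beta> y i"
  have "?A k * (2 * ?c) \<le> ?A k * (y k \<bullet> y j - (y i \<bullet> y k) * ?c)" if k: "k \<in> {1..n}" for k
  proof (rule mult_left_mono)
    have "(y i \<bullet> y k) * ?c \<le> (-1) * ?c"
      using inner_bounds_of_unit[OF sph[OF i] sph[OF k]] neg by (intro mult_right_mono_neg) auto
    with min[OF k j] show "2 * ?c \<le> y k \<bullet> y j - (y i \<bullet> y k) * ?c" by simp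
  qed (rule rope_attention_nonneg[OF i])
  then have "(\<Sum>k=1..n. ?A k * (2 * ?c)) \<le> rope_field n p \<omega> \<beta> y i \<bullet> y j"
    unfolding inner_rope_field by (intro sum_mono)
  then show ?thesis using sum_rope_attention[OF i, of p \<omega> \<beta> y]
    by (simp flip: sum_distrib_right)
qed

section \<open>Minima of finitely many differentiable functions\<close>

text \<open>This is the local step for both results on families below: a function that equals \<open>m\<close> at \<open>t\<close>
  stays above the line of slope \<open>K\<close> by its derivative, one that exceeds \<open>m\<close> does so by continuity.\<close>

lemma eventually_at_right_gt_affine:
  fixes f :: "real \<Rightarrow> real"
  assumes der: "(f has_real_derivative f') (at t within {t..})"
    and ge: "f t \<ge> m" and active: "f t = m \<Longrightarrow> f' > K"
  shows "eventually (\<lambda>s. f s > m + K * (s - t)) (at_right t)"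
proof (cases "f t = m")
  case True
  have "((\<lambda>s. (f s - f t) / (s - t)) \<longlongrightarrow> f') (at_right t)"
    using DERIV_subset[OF der, of "{t<..}"] by (force simp: has_field_derivative_iff)
  from order_tendstoD(1)[OF this active[OF True]]
  have "eventually (\<lambda>s. K < (f s - f t) / (s - t)) (at_right t)" .
  then show ?thesis
    using eventually_at_right_less[of t]
    by eventually_elim (use True in \<open>simp add: field_simps\<close>)
next
  case False
  have "(f \<longlongrightarrow> f t) (at t within {t..})"
    using DERIV_continuous[OF der] by (simp add: continuous_within)
  then have "(f \<longlongrightarrow> f t) (at_right t)"
    by (rule tendsto_within_subset) auto
  then have "((\<lambda>s. f s - (m + K * (s - t))) \<longlongrightarrow> f t - (m + K * (t - t))) (at_right t)"
    by (intro tendsto_intros)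
  from order_tendstoD(1)[OF this, of 0] False ge show ?thesis by simp
qed

text \<open>A comparison principle: only members that attain the minimum of the family and have fallen
  below \<open>K\<close> need a nonnegative derivative. The family is compared with the decreasing barrier
  \<open>K - \<epsilon> * (1 + t)\<close>. At the last time at which no member lies below it, a member touching
  the barrier is minimal and below \<open>K\<close>, so its slope exceeds \<open>- \<epsilon>\<close> and the family stays above
  the barrier a little longer. The \<open>1 +\<close> keeps the barrier strictly below \<open>K\<close> at time \<open>0\<close> as
  well.\<close>

lemma family_lower_bound_preserved:
  fixes g g' :: "'i \<Rightarrow> real \<Rightarrow> real"
  assumes fin: "finite I"
    and der: "\<And>i t. i \<in> I \<Longrightarrow> t \<ge> 0 \<Longrightarrow> (g i has_real_derivative g' i t) (at t within {0..})"
    and active: "\<And>i t. i \<in> I \<Longrightarrow> t \<ge> 0 \<Longrightarrow> (\<And>j. j \<in> I \<Longrightarrow> g i t \<le> g j t) \<Longrightarrow>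
      g i t < K \<Longrightarrow> g' i t \<ge> 0"
    and init: "\<And>i. i \<in> I \<Longrightarrow> K \<le> g i 0"
    and i: "i \<in> I" and t: "t \<ge> 0"
  shows "K \<le> g i t"
proof -
  have cont: "continuous_on {0..} (g i)" if "i \<in> I" for i
    using der[OF that] by (auto intro!: DERIV_continuous_on)
  have "K - \<epsilon> * (1 + t) \<le> g i t" if \<epsilon>: "\<epsilon> > 0" for \<epsilon>
  proof -
    define S where "S = {s \<in> {0..t}. \<forall>j\<in>I. K - \<epsilon> * (1 + s) \<le> g j s}"
    have "S = {0..t} \<inter> (\<Inter>j\<in>I. {s \<in> {0..t}. K - \<epsilon> * (1 + s) \<le> g j s})"
      by (auto simp: S_def)
    moreover have "closed {s \<in> {0..t}. K - \<epsilon> * (1 + s) \<le> g j s}" if "j \<in> I" for j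
      by (rule continuous_on_closed_Collect_le)
        (auto intro!: continuous_intros continuous_on_subset[OF cont[OF that]])
    ultimately have "compact S"
      by (auto intro!: compact_Int_closed closed_INT)
    moreover have "0 \<in> S" using init t \<epsilon> by (fastforce simp: S_def)
    then have "S \<noteq> {}" by blast
    ultimately obtain s where s: "s \<in> S" and sup: "\<And>s'. s' \<in> S \<Longrightarrow> s' \<le> s"
      using compact_attains_sup by metis
    have s0: "0 \<le> s" "s \<le> t" and bound: "\<And>j. j \<in> I \<Longrightarrow> K - \<epsilon> * (1 + s) \<le> g j s"
      using s by (auto simp: S_def)
    have "s = t"
    proof (rule ccontr)
      assume "s \<noteq> t"
      with s0 have "s < t" by simp
      have "eventually (\<lambda>u. g j u > (K - \<epsilon> * (1 + s)) + (- \<epsilon>) * (u - s)) (at_right s)" if j: "j \<in> I" for j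
      proof (rule eventually_at_right_gt_affine)
        show "(g j has_real_derivative g' j s) (at s within {s..})"
          using der[OF j s0(1)] by (rule DERIV_subset) (use s0 in auto)
        show "- \<epsilon> < g' j s" if "g j s = K - \<epsilon> * (1 + s)"
        proof -
          from \<epsilon> s0 have "\<epsilon> * (1 + s) > 0" by simp
          then have "g' j s \<ge> 0" using active[OF j s0(1)] bound that by simp
          with \<epsilon> show ?thesis by simp
        qed
      qed (rule bound[OF j])
      then have "eventually (\<lambda>u. \<forall>j\<in>I. g j u > (K - \<epsilon> * (1 + s)) + (- \<epsilon>) * (u - s)) (at_right s)"
        by (intro eventually_ball_finite fin) auto
      then have "eventually (\<lambda>u. u \<in> S \<and> s < u) (at_right s)"
        using eventually_at_right_real[OF \<open>s < t\<close>]
        by eventually_elim (use s0 in \<open>auto simp: S_def algebra_simps less_imp_le\<close>)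
      then obtain u where "u \<in> S" "s < u"
        using eventually_happens'[of "at_right s"] by auto
      with sup show False by fastforce
    qed
    with bound[OF i] show ?thesis by simp
  qed
  then have "\<forall>\<^sub>F \<epsilon> in at_right 0. K - \<epsilon> * (1 + t) \<le> g i t"
    by (simp add: eventually_at_filter)
  moreover have "((\<lambda>\<epsilon>. K - \<epsilon> * (1 + t)) \<longlongrightarrow> K - 0 * (1 + t)) (at_right 0)"
    by (intro tendsto_intros)
  ultimately show ?thesis
    using tendsto_upperbound[of _ "K - 0 * (1 + t)" "at_right (0::real)" "g i t"] by simp
qed

text \<open>Just after \<open>t\<close>, every member stays above the line of slope \<open>K\<close> through the minimum, for any
  \<open>K < L\<close>; hence so does the minimum of the finite family. This bounds even the lower Dini
  derivative.\<close>

lemma upper_right_Dini_Min_ge: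
  fixes f f' :: "'i \<Rightarrow> real \<Rightarrow> real"
  assumes fin: "finite I" "I \<noteq> {}"
    and der: "\<And>i. i \<in> I \<Longrightarrow> (f i has_real_derivative f' i t) (at t within {t..})"
    and active: "\<And>i. i \<in> I \<Longrightarrow> (\<And>j. j \<in> I \<Longrightarrow> f i t \<le> f j t) \<Longrightarrow> f' i t \<ge> L"
  shows "upper_right_Dini (\<lambda>s. Min ((\<lambda>i. f i s) ` I)) t \<ge> ereal L"
proof -
  define m where "m = (\<lambda>s. Min ((\<lambda>i. f i s) ` I))"
  have m_le: "m s \<le> f i s" if "i \<in> I" for i s
    using that fin by (simp add: m_def)
  have *: "ereal K \<le> Limsup (at_right 0) (\<lambda>h. ereal ((m (t + h) - m t) / h))" if "K < L" for K
  proof -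
    have "eventually (\<lambda>s. f i s > m t + K * (s - t)) (at_right t)" if i: "i \<in> I" for i
    proof (rule eventually_at_right_gt_affine[OF der[OF i] m_le[OF i]])
      assume "f i t = m t"
      then have "f' i t \<ge> L" using active[OF i] m_le by metis
      with \<open>K < L\<close> show "K < f' i t" by simp
    qed
    then have "eventually (\<lambda>s. \<forall>i\<in>I. f i s > m t + K * (s - t)) (at_right t)"
      by (intro eventually_ball_finite fin) auto
    then have "eventually (\<lambda>s. m s > m t + K * (s - t)) (at_right t)"
      by eventually_elim (use fin in \<open>simp add: m_def\<close>)
    then have "eventually (\<lambda>h. m (h + t) > m t + K * (h + t - t)) (at_right 0)"
      by (subst (asm) eventually_at_right_to_0)
    then have "eventually (\<lambda>h. ereal K \<le> ereal ((m (t + h) - m t) / h)) (at_right 0)"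
      using eventually_at_right_less[of 0]
      by eventually_elim (simp add: field_simps)
    then have "ereal K \<le> Liminf (at_right 0) (\<lambda>h. ereal ((m (t + h) - m t) / h))"
      by (rule Liminf_bounded)
    also have "\<dots> \<le> Limsup (at_right 0) (\<lambda>h. ereal ((m (t + h) - m t) / h))"
      by (rule Liminf_le_Limsup) (rule trivial_limit_at_right_real)
    finally show ?thesis .
  qed
  have "ereal L \<le> Limsup (at_right 0) (\<lambda>h. ereal ((m (t + h) - m t) / h))"
  proof (rule dense_le)
    fix z assume "z < ereal L"
    with * show "z \<le> Limsup (at_right 0) (\<lambda>h. ereal ((m (t + h) - m t) / h))"
      by (cases z) auto
  qed
  then show ?thesis unfolding upper_right_Dini_def m_def .
qed

section \<open>Minimal inner product and diameter\<close>

definition index_pairs :: "nat \<Rightarrow> (nat \<times> nat) set" where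
  "index_pairs n = {(i, j). 1 \<le> i \<and> i < j \<and> j \<le> n}"

lemma finite_index_pairs: "finite (index_pairs n)"
  by (rule finite_subset[of _ "{1..n} \<times> {1..n}"]) (auto simp: index_pairs_def)

lemma index_pairs_nonempty: "n \<ge> 2 \<Longrightarrow> index_pairs n \<noteq> {}"
  by (force simp: index_pairs_def)

lemma min_pair_inner_eq_Min: "min_pair_inner n y = Min ((\<lambda>(i, j). y i \<bullet> y j) ` index_pairs n)"
  unfolding min_pair_inner_def index_pairs_def by (rule arg_cong[where f = Min]) auto

lemma min_pair_inner_le:
  assumes "(i, j) \<in> index_pairs n"
  shows "min_pair_inner n y \<le> y i \<bullet> y j"
  unfolding min_pair_inner_eq_Min using assms finite_index_pairs[of n] by (auto intro!: Min_le)

lemma min_pair_inner_attained: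
  assumes "n \<ge> 2"
  obtains i j where "(i, j) \<in> index_pairs n" "min_pair_inner n y = y i \<bullet> y j"
proof -
  have "min_pair_inner n y \<in> (\<lambda>(i, j). y i \<bullet> y j) ` index_pairs n"
    unfolding min_pair_inner_eq_Min using index_pairs_nonempty[OF assms] finite_index_pairs[of n]
    by (intro Min_in) auto
  then show thesis using that by auto
qed

lemma geodesic_diameter_eq_arccos:
  assumes "n \<ge> 2" and sph: "\<And>k. k \<in> {1..n} \<Longrightarrow> norm (y k) = 1"
  shows "geodesic_diameter n y = arccos (min_pair_inner n y)"
proof -
  obtain i j where ij: "(i, j) \<in> index_pairs n" "min_pair_inner n y = y i \<bullet> y j"
    using min_pair_inner_attained[OF \<open>n \<ge> 2\<close>] by metis
  have "geodesic_diameter n y = Max ((\<lambda>(i, j). arccos (y i \<bullet> y j)) ` index_pairs n)"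
    unfolding geodesic_diameter_def index_pairs_def by (rule arg_cong[where f = Max]) auto
  also have "\<dots> = arccos (y i \<bullet> y j)"
  proof (rule Max_eqI)
    fix d assume "d \<in> (\<lambda>(i, j). arccos (y i \<bullet> y j)) ` index_pairs n"
    then obtain k l where kl: "(k, l) \<in> index_pairs n" "d = arccos (y k \<bullet> y l)" by auto
    then have "y i \<bullet> y j \<le> y k \<bullet> y l" "\<bar>y i \<bullet> y j\<bar> \<le> 1" "\<bar>y k \<bullet> y l\<bar> \<le> 1"
      using ij min_pair_inner_le[OF kl(1), of y] inner_bounds_of_unit[OF sph sph, of i j]
        inner_bounds_of_unit[OF sph sph, of k l]
      by (auto simp: index_pairs_def abs_le_iff)
    then show "d \<le> arccos (y i \<bullet> y j)" unfolding kl(2) by (subst arccos_le_mono) auto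
  qed (use ij finite_index_pairs[of n] in auto)
  finally show ?thesis using ij by simp
qed

lemma tan_half_arccos:
  assumes "0 \<le> c" "c \<le> 1"
  shows "tan (arccos c / 2) = sqrt ((1 - c) / (1 + c))"
proof -
  have "tan (arccos c / 2) = sin (arccos c) / (cos (arccos c) + 1)"
    using tan_half[of "arccos c / 2"] by simp
  also have "\<dots> = sqrt (1 - c\<^sup>2) / (1 + c)"
    using assms by (simp add: sin_arccos cos_arccos)
  also have "\<dots> = sqrt ((1 - c\<^sup>2) / (1 + c)\<^sup>2)"
    using assms by (simp add: real_sqrt_divide)
  also have "(1 - c\<^sup>2) / (1 + c)\<^sup>2 = (1 - c) / (1 + c)"
    using assms by (simp add: divide_simps power2_eq_square) (simp add: algebra_simps)
  finally show ?thesis .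
qed

section \<open>Contraction\<close>

context
  fixes n :: nat and p :: "nat \<Rightarrow> real" and \<omega> :: "'r::finite \<Rightarrow> real" and \<beta> a :: real
    and x :: "real \<Rightarrow> nat \<Rightarrow> real^('r \<times> 2)"
  assumes n: "n \<ge> 2" and \<beta>: "\<beta> \<ge> 0" and sol: "rope_flow_solution n p \<omega> \<beta> x"
    and a: "a = 1 / (1 + (real n - 1) * exp (2 * \<beta>))"
begin

text \<open>The product rule for \<open>\<langle>x i, x j\<rangle>\<close> along the flow.\<close>

definition pair_inner_deriv :: "nat \<times> nat \<Rightarrow> real \<Rightarrow> real" where
  "pair_inner_deriv = (\<lambda>(i, j) t.
    rope_field n p \<omega> \<beta> (x t) i \<bullet> x t j + rope_field n p \<omega> \<beta> (x t) j \<bullet> x t i)"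

abbreviation "pair_inner \<equiv> \<lambda>(i, j) t. x t i \<bullet> x t j"

lemma norm_state_eq_1: "t \<ge> 0 \<Longrightarrow> k \<in> {1..n} \<Longrightarrow> norm (x t k) = 1"
  using sol by (auto simp: rope_flow_solution_def)

lemma pair_inner_has_derivative:
  assumes "q \<in> index_pairs n" "t \<ge> 0"
  shows "(pair_inner q has_real_derivative pair_inner_deriv q t) (at t within {0..})"
proof -
  obtain i j where q: "q = (i, j)" "i \<in> {1..n}" "j \<in> {1..n}"
    using assms by (auto simp: index_pairs_def)
  have "((\<lambda>s. x s k) has_vector_derivative rope_field n p \<omega> \<beta> (x t) k) (at t within {0..})"
    if "k \<in> {1..n}" for k
    using sol that assms(2) by (auto simp: rope_flow_solution_def)
  note d = this[OF q(2)] this[OF q(3)]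
  show ?thesis
    unfolding has_field_derivative_def q(1) prod.case pair_inner_deriv_def
    by (rule has_derivative_eq_rhs[OF has_derivative_inner[OF d[unfolded has_vector_derivative_def]]])
      (simp add: fun_eq_iff inner_commute algebra_simps)
qed

lemma a_pos: "a > 0"
  unfolding a using n by (intro divide_pos_pos add_pos_nonneg mult_nonneg_nonneg) auto

text \<open>The two bounds on the field apply to \<open>x i\<close> against \<open>x j\<close> and to \<open>x j\<close> against \<open>x i\<close>, which
  doubles the constants.\<close>

lemma pair_inner_deriv_ge:
  assumes q: "q \<in> index_pairs n" and t: "t \<ge> 0"
    and min: "\<And>q'. q' \<in> index_pairs n \<Longrightarrow> pair_inner q t \<le> pair_inner q' t"
  shows "pair_inner q t \<ge> 0 \<Longrightarrow> pair_inner_deriv q t \<ge> 2 * a * (1 - (pair_inner q t)\<^sup>2)"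
    and "pair_inner q t < 0 \<Longrightarrow> pair_inner_deriv q t \<ge> 4 * pair_inner q t"
proof -
  obtain i j where ij: "q = (i, j)" "i \<in> {1..n}" "j \<in> {1..n}"
    using q by (auto simp: index_pairs_def)
  have le: "x t i \<bullet> x t j \<le> x t k \<bullet> x t l" if "k \<in> {1..n}" "l \<in> {1..n}" for k l
  proof -
    consider "k < l" | "k = l" | "l < k" by linarith
    then show ?thesis
    proof cases
      case 1
      with min[of "(k, l)"] that ij show ?thesis by (auto simp: index_pairs_def)
    next
      case 2
      with inner_bounds_of_unit(1)[OF norm_state_eq_1 norm_state_eq_1, of t i t j] that ij t show ?thesis
        by (simp add: dot_square_norm norm_state_eq_1)
    next
      case 3
      with min[of "(l, k)"] that ij show ?thesis by (auto simp: index_pairs_def inner_commute)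
    qed
  qed
  have le': "x t j \<bullet> x t i \<le> x t k \<bullet> x t l" if "k \<in> {1..n}" "l \<in> {1..n}" for k l
    using le[OF that] by (simp add: inner_commute)
  note field_nonneg = inner_rope_field_ge_if_min_nonneg[where y = "x t", OF norm_state_eq_1[OF t] \<beta>]
  show "pair_inner_deriv q t \<ge> 2 * a * (1 - (pair_inner q t)\<^sup>2)" if "pair_inner q t \<ge> 0"
  proof -
    have c: "x t i \<bullet> x t j \<ge> 0" "x t j \<bullet> x t i \<ge> 0"
      using that ij(1) by (simp_all add: inner_commute)
    from field_nonneg[OF _ ij(2,3) le c(1), of p \<omega>] field_nonneg[OF _ ij(3,2) le' c(2), of p \<omega>]
    show ?thesis
      by (simp add: ij(1) pair_inner_deriv_def inner_commute[of "x t j" "x t i"] flip: a)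
  qed
  note field_neg = inner_rope_field_ge_if_min_neg[where y = "x t", OF norm_state_eq_1[OF t]]
  show "pair_inner_deriv q t \<ge> 4 * pair_inner q t" if "pair_inner q t < 0"
  proof -
    have c: "x t i \<bullet> x t j < 0" "x t j \<bullet> x t i < 0"
      using that ij(1) by (simp_all add: inner_commute)
    from field_neg[OF _ ij(2,3) le c(1), of p \<omega> \<beta>] field_neg[OF _ ij(3,2) le' c(2), of p \<omega> \<beta>]
    show ?thesis
      by (simp add: ij(1) pair_inner_deriv_def inner_commute[of "x t j" "x t i"])
  qed
qed

text \<open>The factor \<open>exp (-4 * t)\<close> leaves signs and minimal pairs unchanged and turns the bound
  \<open>f' \<ge> 4 * f\<close>, valid for minimal \<open>f < 0\<close>, into a nonnegative derivative. The comparison principle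
  asks for it only below the level \<open>0\<close>.\<close>

lemma min_pair_inner_nonneg:
  assumes init: "min_pair_inner n (x 0) \<ge> 0" and t: "t \<ge> 0"
  shows "min_pair_inner n (x t) \<ge> 0"
proof -
  have "0 \<le> exp (- 4 * t) * pair_inner q t" if q: "q \<in> index_pairs n" for q
  proof (rule family_lower_bound_preserved[where I = "index_pairs n"
        and g = "\<lambda>q t. exp (- 4 * t) * pair_inner q t"
        and g' = "\<lambda>q t. exp (- 4 * t) * (pair_inner_deriv q t - 4 * pair_inner q t)"])
    fix q and t :: real assume q: "q \<in> index_pairs n" and t: "t \<ge> 0"
    show "((\<lambda>t. exp (- 4 * t) * pair_inner q t) has_real_derivative
        exp (- 4 * t) * (pair_inner_deriv q t - 4 * pair_inner q t)) (at t within {0..})"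
      using pair_inner_has_derivative[OF q t]
      by (auto intro!: derivative_eq_intros simp: algebra_simps)
    assume "exp (- 4 * t) * pair_inner q t \<le> exp (- 4 * t) * pair_inner q' t"
      if "q' \<in> index_pairs n" for q'
    then have min: "pair_inner q t \<le> pair_inner q' t" if "q' \<in> index_pairs n" for q'
      using that by simp
    assume "exp (- 4 * t) * pair_inner q t < 0"
    then have "pair_inner q t < 0" by (simp add: mult_less_0_iff)
    from pair_inner_deriv_ge(2)[OF q t min this]
    show "0 \<le> exp (- 4 * t) * (pair_inner_deriv q t - 4 * pair_inner q t)" by simp
  next
    fix q assume "q \<in> index_pairs n"
    then show "0 \<le> exp (- 4 * 0) * pair_inner q 0"
      using min_pair_inner_le[of "fst q" "snd q" n "x 0"] init by (auto simp: case_prod_beta)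
  qed (use q t finite_index_pairs in auto)
  then have *: "0 \<le> pair_inner q t" if "q \<in> index_pairs n" for q
    using that by (simp add: zero_le_mult_iff)
  obtain i j where "(i, j) \<in> index_pairs n" "min_pair_inner n (x t) = x t i \<bullet> x t j"
    using min_pair_inner_attained[OF n] by metis
  with *[of "(i, j)"] show ?thesis by simp
qed

text \<open>On \<open>[0, \<infinity>)\<close> the map \<open>u \<mapsto> - (1 - u) / (1 + u)\<close> is increasing, so at each time the members of
  the transformed family that are minimal come from minimal pairs, and the transformed
  derivative has the sign of \<open>f' - 2 * a * (1 - f\<^sup>2)\<close>.\<close>

lemma min_pair_inner_ratio_decay:
  assumes init: "min_pair_inner n (x 0) \<ge> 0" and t: "t \<ge> 0"
  defines "r \<equiv> \<lambda>c :: real. (1 - c) / (1 + c)"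
  shows "r (min_pair_inner n (x t)) \<le> r (min_pair_inner n (x 0)) * exp (- 4 * a * t)"
proof -
  have pos: "pair_inner q t \<ge> 0" if "q \<in> index_pairs n" "t \<ge> 0" for q t
    using min_pair_inner_nonneg[OF init that(2)] min_pair_inner_le[of "fst q" "snd q" n "x t"] that(1)
    by (auto simp: case_prod_beta)
  have r_le: "r u \<le> r v \<longleftrightarrow> v \<le> u" if "u \<ge> 0" "v \<ge> 0" for u v
    using that by (simp add: r_def divide_simps) (simp add: algebra_simps)
  have bound: "- r (min_pair_inner n (x 0)) \<le> - (exp (4 * a * t) * r (pair_inner q t))"
    if q: "q \<in> index_pairs n" for q
  proof (rule family_lower_bound_preserved[where I = "index_pairs n"
        and g = "\<lambda>q t. - (exp (4 * a * t) * r (pair_inner q t))"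
        and g' = "\<lambda>q t. 2 * exp (4 * a * t) *
          (pair_inner_deriv q t - 2 * a * (1 - (pair_inner q t)\<^sup>2)) / (1 + pair_inner q t)\<^sup>2"])
    fix q and t :: real assume q: "q \<in> index_pairs n" and t: "t \<ge> 0"
    define F where "F = pair_inner q"
    have F: "F t \<ge> 0" using pos[OF q t] by (simp add: F_def)
    have "((\<lambda>t. - (exp (4 * a * t) * ((1 - F t) / (1 + F t)))) has_real_derivative
        2 * exp (4 * a * t) * (pair_inner_deriv q t - 2 * a * (1 - (F t)\<^sup>2)) / (1 + F t)\<^sup>2)
        (at t within {0..})"
      using pair_inner_has_derivative[OF q t] F unfolding F_def[symmetric]
      by (auto intro!: derivative_eq_intros simp: divide_simps power2_eq_square)
        (simp add: algebra_simps)
    then show "((\<lambda>t. - (exp (4 * a * t) * r (pair_inner q t))) has_real_derivative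
        2 * exp (4 * a * t) * (pair_inner_deriv q t - 2 * a * (1 - (pair_inner q t)\<^sup>2))
          / (1 + pair_inner q t)\<^sup>2) (at t within {0..})"
      by (simp add: r_def F_def)
    assume "- (exp (4 * a * t) * r (pair_inner q t)) \<le> - (exp (4 * a * t) * r (pair_inner q' t))"
      if "q' \<in> index_pairs n" for q'
    then have "pair_inner q t \<le> pair_inner q' t" if "q' \<in> index_pairs n" for q'
      using that r_le[OF pos[OF that t] pos[OF q t]] by simp
    from pair_inner_deriv_ge(1)[OF q t this pos[OF q t]]
    show "0 \<le> 2 * exp (4 * a * t) *
        (pair_inner_deriv q t - 2 * a * (1 - (pair_inner q t)\<^sup>2)) / (1 + pair_inner q t)\<^sup>2"
      by simp
  next
    fix q assume q: "q \<in> index_pairs n"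
    then have "min_pair_inner n (x 0) \<le> pair_inner q 0"
      using min_pair_inner_le[of "fst q" "snd q" n "x 0"] by (auto simp: case_prod_beta)
    then show "- r (min_pair_inner n (x 0)) \<le> - (exp (4 * a * 0) * r (pair_inner q 0))"
      using r_le[OF pos[OF q] init] by simp
  qed (use q t finite_index_pairs in auto)
  obtain i j where ij: "(i, j) \<in> index_pairs n" "min_pair_inner n (x t) = x t i \<bullet> x t j"
    using min_pair_inner_attained[OF n] by metis
  show ?thesis
    using bound[OF ij(1)] ij(2) by (simp add: exp_minus field_simps)
qed

lemma min_pair_inner_Dini_ge:
  assumes nn: "min_pair_inner n (x t) \<ge> 0" and t: "t \<ge> 0"
  shows "upper_right_Dini (\<lambda>t. min_pair_inner n (x t)) t
    \<ge> ereal (2 * a * (1 - (min_pair_inner n (x t))\<^sup>2))"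
proof -
  have "upper_right_Dini (\<lambda>s. Min ((\<lambda>q. pair_inner q s) ` index_pairs n)) t
    \<ge> ereal (2 * a * (1 - (min_pair_inner n (x t))\<^sup>2))"
  proof (rule upper_right_Dini_Min_ge[where f' = pair_inner_deriv])
    fix q assume q: "q \<in> index_pairs n"
    show "(pair_inner q has_real_derivative pair_inner_deriv q t) (at t within {t..})"
      using pair_inner_has_derivative[OF q t] by (rule DERIV_subset) (use t in auto)
    assume min: "\<And>q'. q' \<in> index_pairs n \<Longrightarrow> pair_inner q t \<le> pair_inner q' t"
    obtain i j where ij: "(i, j) \<in> index_pairs n" "min_pair_inner n (x t) = x t i \<bullet> x t j"
      using min_pair_inner_attained[OF n] by metis
    have "pair_inner q t = min_pair_inner n (x t)"
      using min[OF ij(1)] ij(2) min_pair_inner_le[of "fst q" "snd q" n "x t"] q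
      by (auto simp: case_prod_beta)
    then show "2 * a * (1 - (min_pair_inner n (x t))\<^sup>2) \<le> pair_inner_deriv q t"
      using pair_inner_deriv_ge(1)[OF q t min] nn by simp
  qed (use finite_index_pairs index_pairs_nonempty[OF n] in auto)
  moreover have "(\<lambda>s. Min ((\<lambda>q. pair_inner q s) ` index_pairs n)) = (\<lambda>s. min_pair_inner n (x s))"
    unfolding min_pair_inner_eq_Min
    by (intro ext arg_cong[where f = Min] image_cong) auto
  ultimately show ?thesis by (simp only:)
qed

end

theorem theorem6p2:
  fixes n :: nat and p :: "nat \<Rightarrow> real" and \<omega> :: "'r::finite \<Rightarrow> real" and \<beta> :: real
    and x :: "real \<Rightarrow> nat \<Rightarrow> real^('r \<times> 2)"
    and a c\<^sub>0 \<rho>\<^sub>0 :: real and c \<rho> D :: "real \<Rightarrow> real"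
  assumes "n \<ge> 2" and "\<beta> \<ge> 0"
    and "rope_flow_solution n p \<omega> \<beta> x"
    and "a = 1 / (1 + (real n - 1) * exp (2 * \<beta>))"
    and "c = (\<lambda>t. min_pair_inner n (x t))"
    and "c 0 = c\<^sub>0" and "c\<^sub>0 \<ge> 0"
    and "\<rho> = (\<lambda>t. (1 - c t) / (1 + c t))"
    and "\<rho>\<^sub>0 = (1 - c\<^sub>0) / (1 + c\<^sub>0)"
    and "D = (\<lambda>t. geodesic_diameter n (x t))"
  shows "(\<forall>t\<ge>0. c t \<ge> 0 \<and>
            upper_right_Dini c t \<ge> ereal (2 * a * (1 - (c t)\<^sup>2)) \<and>
            \<rho> t \<le> \<rho>\<^sub>0 * exp (- 4 * a * t) \<and>
            D t = arccos (c t) \<and>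
            tan (D t / 2) \<le> tan (D 0 / 2) * exp (- 2 * a * t)) \<and>
         (c\<^sub>0 = 0 \<longrightarrow> (\<forall>t>0. c t \<ge> tanh (2 * a * t) \<and> tanh (2 * a * t) > 0))"
proof -
  note n = \<open>n \<ge> 2\<close> and flow = \<open>n \<ge> 2\<close> \<open>\<beta> \<ge> 0\<close> \<open>rope_flow_solution n p \<omega> \<beta> x\<close> assms(4)
  have c: "c t = min_pair_inner n (x t)" for t by (simp add: assms(5))
  have init: "min_pair_inner n (x 0) \<ge> 0" using assms(6,7) c[of 0] by simp
  have sph: "norm (x t k) = 1" if "t \<ge> 0" "k \<in> {1..n}" for t k
    using norm_state_eq_1[OF flow] that by simp
  have nonneg: "c t \<ge> 0" if "t \<ge> 0" for t
    using min_pair_inner_nonneg[OF flow init that] c by simp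
  have le1: "c t \<le> 1" if t: "t \<ge> 0" for t
  proof -
    obtain i j where ij: "(i, j) \<in> index_pairs n" "c t = x t i \<bullet> x t j"
      using min_pair_inner_attained[OF n] c by metis
    then show ?thesis
      using inner_bounds_of_unit(1)[OF sph sph, of t i t j] t by (auto simp: index_pairs_def)
  qed
  have dini: "upper_right_Dini c t \<ge> ereal (2 * a * (1 - (c t)\<^sup>2))" if "t \<ge> 0" for t
    using min_pair_inner_Dini_ge[OF flow min_pair_inner_nonneg[OF flow init that] that]
    by (simp add: assms(5))
  have decay: "\<rho> t \<le> \<rho>\<^sub>0 * exp (- 4 * a * t)" if "t \<ge> 0" for t
    using min_pair_inner_ratio_decay[OF flow init that] c[of t] c[of 0] assms(6)
    by (simp add: assms(8,9))
  have D: "D t = arccos (c t)" if "t \<ge> 0" for t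
    using geodesic_diameter_eq_arccos[OF n, of "x t"] sph that c[of t] by (simp add: assms(10))
  have tan_D: "tan (D t / 2) = sqrt (\<rho> t)" if "t \<ge> 0" for t
    using tan_half_arccos[OF nonneg[OF that] le1[OF that]] D[OF that] by (simp add: assms(8))
  have tan_decay: "tan (D t / 2) \<le> tan (D 0 / 2) * exp (- 2 * a * t)" if t: "t \<ge> 0" for t
  proof -
    have "sqrt (\<rho> t) \<le> sqrt (\<rho>\<^sub>0 * exp (- 4 * a * t))" using decay[OF t] by simp
    also have "exp (- 4 * a * t) = (exp (- 2 * a * t))\<^sup>2"
      by (simp flip: exp_double)
    also have "sqrt (\<rho>\<^sub>0 * (exp (- 2 * a * t))\<^sup>2) = sqrt \<rho>\<^sub>0 * exp (- 2 * a * t)"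
      by (simp add: real_sqrt_mult)
    also have "\<rho>\<^sub>0 = \<rho> 0"
      by (simp add: assms(6,8,9))
    finally show ?thesis
      using tan_D[OF t] tan_D[of 0] by simp
  qed
  have tanh: "c t \<ge> tanh (2 * a * t) \<and> tanh (2 * a * t) > 0" if "c\<^sub>0 = 0" "t > 0" for t
  proof
    have "(1 - c t) / (1 + c t) \<le> exp (- 4 * a * t)"
      using decay[of t] that by (simp add: assms(8,9))
    moreover have "tanh (2 * a * t) = (1 - exp (- 4 * a * t)) / (1 + exp (- 4 * a * t))"
      by (simp add: tanh_real_altdef mult.assoc)
    moreover have "(1 - E) / (1 + E) \<le> u" if "(1 - u) / (1 + u) \<le> E" "E > 0" "u \<ge> 0" for E u :: real
      using that by (simp add: divide_simps) (simp add: algebra_simps)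
    ultimately show "c t \<ge> tanh (2 * a * t)"
      using nonneg[of t] that by simp
    show "tanh (2 * a * t) > 0"
      using a_pos[OF flow] that by simp
  qed
  show ?thesis
    by (intro conjI allI impI nonneg dini decay D tan_decay tanh[THEN conjunct1] tanh[THEN conjunct2])
qed

end
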